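(* Let $(\gamma_n)_{n\in\mathbb N}$, $(\tilde\gamma_n)_{n\in\mathbb N}$, $(a_j(n))_{0\le j\le n}$ and $(b_j(n))_{0\le j\le n}$ be complex numbers, and let $\{\pi_n(x)\}_{n\in\mathbb N}\subset\mathbb C[x]$ and $\{\sigma_n(y)\}_{n\in\mathbb N}\subset\mathbb C[y]$ be the sequences of polynomials determined by nonzero constants $\pi_0$, $\sigma_0$ and the recurrence relations $$x\,\pi_n(x)=\gamma_n\,\pi_{n+1}(x)+\sum_{j=0}^n a_j(n)\,\pi_{n-j}(x),\qquad y\,\sigma_n(y)=\tilde\gamma_n\,\sigma_{n+1}(y)+\sum_{j=0}^n b_j(n)\,\sigma_{n-j}(y),\qquad n\in\mathbb N.$$ If $\gamma_n\ne 0$ and $\tilde\gamma_n\neq 0$ for all $n\in\mathbb N$, then there exists a unique bi-moment functional $\mathcal L:\mathbb C[x]\otimes_{\mathbb C}\mathbb C[y]\to\mathbb C$ for which the two sequences $\{\pi_n\}$ and $\{\sigma_n\}$ are biorthogonal.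
   Context: Here $\mathbb N=\{0,1,2,\dots\}$. A bi-moment functional (moment bifunctional) is a $\mathbb C$-linear functional $\mathcal L:\mathbb C[x]\otimes_{\mathbb C}\mathbb C[y]\to\mathbb C$; one writes $\mathcal L(p|s)$ for $\mathcal L(p(x)\otimes s(y))$. Two sequences of polynomials $\{\pi_n(x)\}_{n\in\mathbb N}$, $\{\sigma_n(y)\}_{n\in\mathbb N}$, with $\pi_n$ and $\sigma_n$ of exact degree $n$, are biorthogonal with respect to $\mathcal L$ if $\mathcal L(\pi_n|\sigma_m)=\delta_{nm}$ for all $n,m\in\mathbb N$. *)

theory Defs
  imports Complex_Main "HOL-Library.Poly_Mapping" "HOL-Computational_Algebra.Polynomial"
begin

type_synonym free_poly_pairs = "(complex poly \<times> complex poly) \<Rightarrow>\<^sub>0 complex"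

definition free_scale :: "complex \<Rightarrow> free_poly_pairs \<Rightarrow> free_poly_pairs" where
  "free_scale c f = Poly_Mapping.map ((*) c) f"

lemma lookup_free_scale [simp]:
  "poly_mapping.lookup (free_scale c f) k = c * poly_mapping.lookup f k"
  by (cases "poly_mapping.lookup f k = 0")
    (simp_all add: free_scale_def Poly_Mapping.map.rep_eq when_def)

interpretation free_vs: vector_space free_scale
  by unfold_locales (auto intro!: poly_mapping_eqI simp: lookup_add algebra_simps)

inductive_set bilinear_relations :: "free_poly_pairs set" where
  add_left: "Poly_Mapping.single (p + q, s) 1
    - (Poly_Mapping.single (p, s) 1 + Poly_Mapping.single (q, s) 1) \<in> bilinear_relations"
| add_right: "Poly_Mapping.single (p, s + t) 1
    - (Poly_Mapping.single (p, s) 1 + Poly_Mapping.single (p, t) 1) \<in> bilinear_relations"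
| smult_left: "Poly_Mapping.single (smult c p, s) 1
    - free_scale c (Poly_Mapping.single (p, s) 1) \<in> bilinear_relations"
| smult_right: "Poly_Mapping.single (p, smult c s) 1
    - free_scale c (Poly_Mapping.single (p, s) 1) \<in> bilinear_relations"

definition tensor_rel :: "free_poly_pairs \<Rightarrow> free_poly_pairs \<Rightarrow> bool" where
  "tensor_rel f g \<longleftrightarrow> f - g \<in> free_vs.span bilinear_relations"

lemma equivp_tensor_rel: "equivp tensor_rel"
proof (rule equivpI)
  show "reflp tensor_rel"
    by (auto intro!: reflpI simp: tensor_rel_def free_vs.span_zero)
  show "symp tensor_rel"
  proof (rule sympI)
    fix x y assume "tensor_rel x y"
    then have "- (x - y) \<in> free_vs.span bilinear_relations"
      unfolding tensor_rel_def by (rule free_vs.span_neg)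
    then show "tensor_rel y x" by (simp add: tensor_rel_def)
  qed
  show "transp tensor_rel"
  proof (rule transpI)
    fix x y z assume "tensor_rel x y" "tensor_rel y z"
    then have "(x - y) + (y - z) \<in> free_vs.span bilinear_relations"
      unfolding tensor_rel_def by (rule free_vs.span_add)
    then show "tensor_rel x z" by (simp add: tensor_rel_def)
  qed
qed

text \<open>The tensor product \<open>\<complex>[x] \<otimes> \<complex>[y]\<close> over \<open>\<complex>\<close>: the free vector space on pairs of polynomials
  modulo the subspace generated by the bilinearity relations.\<close>

quotient_type poly_tensor = free_poly_pairs / tensor_rel
  by (rule equivp_tensor_rel)

instantiation poly_tensor :: ab_group_add
begin

lift_definition zero_poly_tensor :: poly_tensor is 0 .

lift_definition plus_poly_tensor :: "poly_tensor \<Rightarrow> poly_tensor \<Rightarrow> poly_tensor" is "(+)"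
  unfolding tensor_rel_def by (simp add: add_diff_add free_vs.span_add)

lift_definition uminus_poly_tensor :: "poly_tensor \<Rightarrow> poly_tensor" is uminus
  unfolding tensor_rel_def by (metis free_vs.span_neg minus_diff_minus)

lift_definition minus_poly_tensor :: "poly_tensor \<Rightarrow> poly_tensor \<Rightarrow> poly_tensor" is "(-)"
  unfolding tensor_rel_def
  by (metis (no_types, lifting) add_diff_add diff_conv_add_uminus free_vs.span_diff minus_diff_minus)

instance
  by (standard; transfer; simp add: tensor_rel_def free_vs.span_zero algebra_simps)

end

lift_definition tensor_scale :: "complex \<Rightarrow> poly_tensor \<Rightarrow> poly_tensor" is free_scale
  unfolding tensor_rel_def by (metis free_vs.scale_right_diff_distrib free_vs.span_scale)

interpretation poly_tensor: vector_space tensor_scale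
  by (unfold_locales; transfer)
     (simp_all add: tensor_rel_def free_vs.span_zero free_vs.scale_right_distrib
        free_vs.scale_left_distrib)

text \<open>The pure tensor \<open>p(x) \<otimes> s(y)\<close>.\<close>

definition tensor :: "complex poly \<Rightarrow> complex poly \<Rightarrow> poly_tensor" where
  "tensor p s = abs_poly_tensor (Poly_Mapping.single (p, s) 1)"

lemma tensor_add_left: "tensor (p + q) s = tensor p s + tensor q s"
  unfolding tensor_def plus_poly_tensor.abs_eq poly_tensor.abs_eq_iff tensor_rel_def
  by (intro free_vs.span_base bilinear_relations.add_left)

lemma tensor_add_right: "tensor p (s + t) = tensor p s + tensor p t"
  unfolding tensor_def plus_poly_tensor.abs_eq poly_tensor.abs_eq_iff tensor_rel_def
  by (intro free_vs.span_base bilinear_relations.add_right)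

lemma tensor_smult_left: "tensor (smult c p) s = tensor_scale c (tensor p s)"
  unfolding tensor_def tensor_scale.abs_eq poly_tensor.abs_eq_iff tensor_rel_def
  by (intro free_vs.span_base bilinear_relations.smult_left)

lemma tensor_smult_right: "tensor p (smult c s) = tensor_scale c (tensor p s)"
  unfolding tensor_def tensor_scale.abs_eq poly_tensor.abs_eq_iff tensor_rel_def
  by (intro free_vs.span_base bilinear_relations.smult_right)

definition bimoment_functional :: "(poly_tensor \<Rightarrow> complex) \<Rightarrow> bool" where
  "bimoment_functional L \<longleftrightarrow> Vector_Spaces.linear tensor_scale (*) L"

lemma tensor_universal:
  fixes B :: "complex poly \<Rightarrow> complex poly \<Rightarrow> complex"
  assumes al: "\<And>p q s. B (p + q) s = B p s + B q s"
    and ar: "\<And>p s t. B p (s + t) = B p s + B p t"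
    and sl: "\<And>c p s. B (smult c p) s = c * B p s"
    and sr: "\<And>c p s. B p (smult c s) = c * B p s"
  shows "\<exists>L. bimoment_functional L \<and> (\<forall>p s. L (tensor p s) = B p s)"
proof -
  define E :: "free_poly_pairs \<Rightarrow> complex"
    where "E f = (\<Sum>k\<in>Poly_Mapping.keys f. poly_mapping.lookup f k * B (fst k) (snd k))" for f
  have ES: "E f = (\<Sum>k\<in>S. poly_mapping.lookup f k * B (fst k) (snd k))"
    if "finite S" "Poly_Mapping.keys f \<subseteq> S" for f S
    unfolding E_def using that by (intro sum.mono_neutral_left) (auto simp: in_keys_iff)
  have Eadd: "E (f + g) = E f + E g" for f g
    using ES[of "Poly_Mapping.keys f \<union> Poly_Mapping.keys g" f]
      ES[of "Poly_Mapping.keys f \<union> Poly_Mapping.keys g" g]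
      ES[of "Poly_Mapping.keys f \<union> Poly_Mapping.keys g" "f + g"] Poly_Mapping.keys_add[of f g]
    by (simp add: lookup_add algebra_simps sum.distrib)
  have Escale: "E (free_scale c f) = c * E f" for c f
    using ES[of "Poly_Mapping.keys f" "free_scale c f"] ES[of "Poly_Mapping.keys f" f]
    by (auto simp: sum_distrib_left algebra_simps in_keys_iff subset_iff)
  have Ediff: "E (f - g) = E f - E g" for f g
    using Eadd[of "f - g" g] by simp
  have Esingle: "E (Poly_Mapping.single k c) = c * B (fst k) (snd k)" for k c
    using ES[of "{k}" "Poly_Mapping.single k c"]
    by (simp add: subset_iff in_keys_iff lookup_single when_def)
  have base: "E r = 0" if "r \<in> bilinear_relations" for r
    using that by cases (simp_all add: Ediff Eadd Escale Esingle al ar sl sr)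
  have span: "E r = 0" if "r \<in> free_vs.span bilinear_relations" for r
    using that
  proof (induction rule: free_vs.span_induct_alt)
    case base show ?case using Ediff[of 0 0] by simp
  next
    case (step c x y) then show ?case by (simp add: Eadd Escale base)
  qed
  have wd: "E (rep_poly_tensor (abs_poly_tensor f)) = E f" for f
  proof -
    have "tensor_rel (rep_poly_tensor (abs_poly_tensor f)) f"
      using poly_tensor.abs_eq_iff Quotient_rep_abs[OF Quotient_poly_tensor]
      by (meson Quotient_poly_tensor equivp_reflp equivp_tensor_rel rep_abs_rsp_left)
    then show ?thesis
      using span Ediff[of "rep_poly_tensor (abs_poly_tensor f)" f] by (simp add: tensor_rel_def)
  qed
  define L where "L t = E (rep_poly_tensor t)" for t
  have L: "L (abs_poly_tensor f) = E f" for f by (simp add: L_def wd)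
  have La: "L (x + y) = L x + L y" for x y
    by (induct x rule: poly_tensor.abs_induct; induct y rule: poly_tensor.abs_induct)
       (simp add: plus_poly_tensor.abs_eq L Eadd)
  have Ls: "L (tensor_scale c x) = c * L x" for c x
    by (induct x rule: poly_tensor.abs_induct) (simp add: tensor_scale.abs_eq L Escale)
  have vs: "vector_space ((*) :: complex \<Rightarrow> _)"
    by unfold_locales (auto simp: algebra_simps)
  have "bimoment_functional L"
    unfolding bimoment_functional_def
    by (simp add: Vector_Spaces.linear_iff vs poly_tensor.vector_space_axioms La Ls)
  moreover have "L (tensor p s) = B p s" for p s by (simp add: tensor_def L Esingle)
  ultimately show ?thesis by blast
qed

text \<open>The condition \<open>p n \<noteq> 0\<close> only matters for \<open>n = 0\<close>, because \<open>degree 0 = 0\<close>.\<close>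

definition exact_degree_seq :: "(nat \<Rightarrow> complex poly) \<Rightarrow> bool" where
  "exact_degree_seq p \<longleftrightarrow> (\<forall>n. p n \<noteq> 0 \<and> degree (p n) = n)"

definition biorthogonal ::
  "(poly_tensor \<Rightarrow> complex) \<Rightarrow> (nat \<Rightarrow> complex poly) \<Rightarrow> (nat \<Rightarrow> complex poly) \<Rightarrow> bool" where
  "biorthogonal L p s \<longleftrightarrow> exact_degree_seq p \<and> exact_degree_seq s \<and>
     (\<forall>n m. L (tensor (p n) (s m)) = (if n = m then 1 else 0))"

end

theory Submission
  imports Defs
begin

text \<open>
  A recurrence of the given form with nonvanishing leading coefficients raises the degree by exactly
  one at every step, so each of the two sequences has exact degrees and hence is a basis of the space
  of polynomials. A linear functional on the tensor product is the same thing as a bilinear form on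
  pairs of polynomials, and a bilinear form can be prescribed freely, and in exactly one way, on pairs
  of basis elements. Biorthogonality prescribes the values \<open>\<delta>\<^sub>n\<^sub>m\<close>.

  Linear extension from a basis is made concrete as follows. The sequence \<open>p\<close> induces the linear map
  \<open>combination p\<close> which replaces the monomial \<open>x\<^sup>i\<close> by \<open>p i\<close>; when \<open>p\<close> has exact degrees this map is
  bijective (\<open>bij_combination\<close>), and its inverse reads off coordinates with respect to \<open>p\<close>. The
  sought bilinear form pairs the coordinates of the first argument with respect to \<open>\<pi>\<close> and those of
  the second with respect to \<open>\<sigma>\<close> by the standard dot product. Uniqueness holds because pure tensors
  span the tensor product (\<open>bimoment_functional_eqI\<close>) and the bases span the polynomials.
\<close>

section \<open>Polynomials in a basis of exact degrees\<close>

definition combination :: "(nat \<Rightarrow> 'a::field poly) \<Rightarrow> 'a poly \<Rightarrow> 'a poly" where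
  "combination p f = (\<Sum>i\<le>degree f. smult (coeff f i) (p i))"

text \<open>The bound may be enlarged so that polynomials of different degrees share one index set.\<close>

lemma combination_eq:
  assumes "degree f \<le> N"
  shows "combination p f = (\<Sum>i\<le>N. smult (coeff f i) (p i))"
  unfolding combination_def using assms
  by (intro sum.mono_neutral_left) (auto intro: coeff_eq_0)

lemma combination_add: "combination p (f + g) = combination p f + combination p g"
proof -
  define N where "N = max (degree f) (degree g)"
  have "degree (f + g) \<le> N" "degree f \<le> N" "degree g \<le> N"
    by (auto simp: N_def degree_add_le)
  then show ?thesis
    by (simp add: combination_eq smult_add_left sum.distrib)
qed

lemma combination_smult: "combination p (smult c f) = smult c (combination p f)"
proof -
  have "smult c (\<Sum>i\<le>degree f. smult (coeff f i) (p i))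
      = (\<Sum>i\<le>degree f. smult c (smult (coeff f i) (p i)))"
    by (simp add: poly_eq_iff coeff_sum sum_distrib_left mult.assoc)
  then show ?thesis
    using combination_eq[of "smult c f" "degree f" p] combination_eq[of f "degree f" p]
    by (simp add: degree_smult_le)
qed

lemma combination_diff: "combination p (f - g) = combination p f - combination p g"
  using combination_add[of p "f - g" g] by simp

lemma combination_monom: "combination p (monom c n) = smult c (p n)"
proof -
  have "combination p (monom c n) = (\<Sum>i\<in>{n}. smult (coeff (monom c n) i) (p i))"
    unfolding combination_eq[OF degree_monom_le] by (intro sum.mono_neutral_right) auto
  then show ?thesis by simp
qed

text \<open>Only the last summand reaches degree \<open>degree f\<close>, so its leading term cannot cancel.\<close>

lemma combination_eq_0_iff:
  assumes "exact_degree_seq p"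
  shows "combination p f = 0 \<longleftrightarrow> f = 0"
proof
  assume 0: "combination p f = 0"
  let ?n = "degree f"
  have "coeff (combination p f) ?n = (\<Sum>i\<le>?n. coeff f i * coeff (p i) ?n)"
    by (simp add: combination_def coeff_sum)
  also have "\<dots> = (\<Sum>i\<in>{?n}. coeff f i * coeff (p i) ?n)"
    using assms by (intro sum.mono_neutral_right) (auto simp: exact_degree_seq_def coeff_eq_0)
  finally have "lead_coeff f * coeff (p ?n) ?n = 0"
    using 0 by simp
  moreover have "coeff (p ?n) ?n \<noteq> 0"
    using assms unfolding exact_degree_seq_def by (metis leading_coeff_0_iff)
  ultimately show "f = 0" by simp
qed (simp add: combination_def)

text \<open>Surjectivity is division with remainder by degree: a multiple of \<open>p n\<close> removes the leading term
  of a polynomial of degree \<open>n\<close>.\<close>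

lemma surj_combination:
  assumes "exact_degree_seq p"
  shows "\<exists>f. combination p f = q"
proof (induction "degree q" arbitrary: q rule: less_induct)
  case less
  let ?n = "degree q"
  define c where "c = lead_coeff q / lead_coeff (p ?n)"
  define r where "r = q - smult c (p ?n)"
  have p: "p ?n \<noteq> 0" "degree (p ?n) = ?n"
    using assms by (auto simp: exact_degree_seq_def)
  have "degree r \<le> ?n"
    unfolding r_def using p by (intro degree_diff_le order_trans[OF degree_smult_le]) auto
  moreover have "coeff r ?n = 0"
    using p leading_coeff_0_iff[of "p ?n"] by (simp add: r_def c_def)
  ultimately have "r = 0 \<or> degree r < ?n"
    by (metis leading_coeff_0_iff order_le_less)
  then obtain f where "combination p f = r"
    using less[of r] by (metis assms combination_eq_0_iff)
  then have "combination p (f + monom c ?n) = q"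
    by (simp add: combination_add combination_monom r_def)
  then show ?case by blast
qed

lemma bij_combination:
  assumes "exact_degree_seq p"
  shows "bij (combination p)"
proof (rule bijI)
  show "inj (combination p)"
  proof (rule injI)
    fix f g assume "combination p f = combination p g"
    then have "combination p (f - g) = 0" by (simp add: combination_diff)
    then show "f = g" using combination_eq_0_iff[OF assms] by auto
  qed
  show "surj (combination p)"
    using surj_combination[OF assms] by (metis surjI)
qed

text \<open>Coordinates with respect to the basis \<open>p\<close>, collected as the coefficients of a polynomial.\<close>

definition coordinates :: "(nat \<Rightarrow> 'a::field poly) \<Rightarrow> 'a poly \<Rightarrow> 'a poly" where
  "coordinates p = inv (combination p)"

lemma coordinates_eq_iff:
  assumes "exact_degree_seq p"
  shows "coordinates p q = f \<longleftrightarrow> combination p f = q"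
  unfolding coordinates_def using bij_combination[OF assms] by (metis bij_inv_eq_iff)

lemma combination_coordinates:
  assumes "exact_degree_seq p"
  shows "combination p (coordinates p q) = q"
  using coordinates_eq_iff[OF assms] by blast

lemma coordinates_add:
  assumes "exact_degree_seq p"
  shows "coordinates p (q + r) = coordinates p q + coordinates p r"
  using assms by (simp add: coordinates_eq_iff combination_add combination_coordinates)

lemma coordinates_smult:
  assumes "exact_degree_seq p"
  shows "coordinates p (smult c q) = smult c (coordinates p q)"
  using assms by (simp add: coordinates_eq_iff combination_smult combination_coordinates)

lemma coordinates_basis:
  assumes "exact_degree_seq p"
  shows "coordinates p (p n) = monom 1 n"
  using assms by (simp add: coordinates_eq_iff combination_monom)

section \<open>The dot product of coefficient sequences\<close>

definition coeff_dot :: "'a::field poly \<Rightarrow> 'a poly \<Rightarrow> 'a" where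
  "coeff_dot f g = (\<Sum>i\<le>degree f. coeff f i * coeff g i)"

lemma coeff_dot_eq:
  assumes "degree f \<le> N"
  shows "coeff_dot f g = (\<Sum>i\<le>N. coeff f i * coeff g i)"
  unfolding coeff_dot_def using assms
  by (intro sum.mono_neutral_left) (auto intro: coeff_eq_0)

lemma coeff_dot_add_left: "coeff_dot (f + g) h = coeff_dot f h + coeff_dot g h"
proof -
  define N where "N = max (degree f) (degree g)"
  have "degree (f + g) \<le> N" "degree f \<le> N" "degree g \<le> N"
    by (auto simp: N_def degree_add_le)
  then show ?thesis
    by (simp add: coeff_dot_eq distrib_right sum.distrib)
qed

lemma coeff_dot_smult_left: "coeff_dot (smult c f) h = c * coeff_dot f h"
  using coeff_dot_eq[of "smult c f" "degree f" h]
  by (simp add: degree_smult_le coeff_dot_def sum_distrib_left mult.assoc)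

lemma coeff_dot_add_right: "coeff_dot f (g + h) = coeff_dot f g + coeff_dot f h"
  by (simp add: coeff_dot_def distrib_left sum.distrib)

lemma coeff_dot_smult_right: "coeff_dot f (smult c h) = c * coeff_dot f h"
  by (simp add: coeff_dot_def sum_distrib_left mult.left_commute)

lemma coeff_dot_monom: "coeff_dot (monom 1 n) (monom 1 m) = (if n = m then 1 else 0)"
proof -
  have "coeff_dot (monom 1 n) (monom 1 m) = (\<Sum>i\<le>n. if i = n then (if n = m then 1 else 0) else 0)"
    unfolding coeff_dot_eq[OF degree_monom_le] by (intro sum.cong) auto
  then show ?thesis by simp
qed

section \<open>Functionals on the tensor product\<close>

lemma bimoment_functional_add:
  "bimoment_functional L \<Longrightarrow> L (t + u) = L t + L u"
  by (simp add: bimoment_functional_def Vector_Spaces.linear_iff)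

lemma bimoment_functional_scale:
  "bimoment_functional L \<Longrightarrow> L (tensor_scale c t) = c * L t"
  by (simp add: bimoment_functional_def Vector_Spaces.linear_iff)

text \<open>Every element of the tensor product is represented by a finite formal combination of pairs, and
  thus is a finite linear combination of pure tensors.\<close>

lemma bimoment_functional_eqI:
  assumes L: "bimoment_functional L" and M: "bimoment_functional M"
    and pure: "\<And>p s. L (tensor p s) = M (tensor p s)"
  shows "L = M"
proof
  fix t
  show "L t = M t"
  proof (induction t rule: poly_tensor.abs_induct)
    case (1 f)
    have single: "abs_poly_tensor (Poly_Mapping.single (p, s) c) = tensor_scale c (tensor p s)" for p s c
    proof -
      have "free_scale c (Poly_Mapping.single (p, s) 1) = Poly_Mapping.single (p, s) c"
        by (rule poly_mapping_eqI) (simp add: lookup_single when_def)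
      then show ?thesis by (simp add: tensor_def tensor_scale.abs_eq)
    qed
    show ?case
    proof (induction f rule: update_induct)
      case const
      show ?case
        using bimoment_functional_scale[OF L, of 0 0] bimoment_functional_scale[OF M, of 0 0]
        by (simp flip: zero_poly_tensor_def)
    next
      case (update f k c)
      have "Poly_Mapping.update k c f = Poly_Mapping.single k c + f"
        using update(1)
        by (intro poly_mapping_eqI) (auto simp: lookup_update lookup_add lookup_single in_keys_iff)
      then have "abs_poly_tensor (Poly_Mapping.update k c f)
          = tensor_scale c (tensor (fst k) (snd k)) + abs_poly_tensor f"
        by (simp flip: plus_poly_tensor.abs_eq single)
      then show ?case
        using update(3)
        by (simp add: bimoment_functional_add[OF L] bimoment_functional_scale[OF L]
            bimoment_functional_add[OF M] bimoment_functional_scale[OF M] pure)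
    qed
  qed
qed

text \<open>Used for each tensor slot separately, with the other slot held fixed.\<close>

lemma linear_functional_eqI:
  fixes F G :: "complex poly \<Rightarrow> complex"
  assumes p: "exact_degree_seq p"
    and F: "\<And>q r. F (q + r) = F q + F r" "\<And>c q. F (smult c q) = c * F q"
    and G: "\<And>q r. G (q + r) = G q + G r" "\<And>c q. G (smult c q) = c * G q"
    and basis: "\<And>n. F (p n) = G (p n)"
  shows "F q = G q"
proof -
  have 0: "F 0 = 0" "G 0 = 0"
    using F(2)[of 0 0] G(2)[of 0 0] by simp_all
  have "F (\<Sum>i\<in>A. smult (c i) (p i)) = G (\<Sum>i\<in>A. smult (c i) (p i))" if "finite A" for A c
    using that by induction (simp_all add: 0 F G basis)
  then have "F (combination p f) = G (combination p f)" for f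
    by (simp add: combination_def)
  then show ?thesis
    using surj_combination[OF p] by metis
qed

lemma biorthogonal_functional_unique:
  assumes L: "bimoment_functional L" "biorthogonal L p s"
    and M: "bimoment_functional M" "biorthogonal M p s"
  shows "L = M"
proof (rule bimoment_functional_eqI[OF L(1) M(1)])
  have p: "exact_degree_seq p" and s: "exact_degree_seq s"
    using L(2) by (auto simp: biorthogonal_def)
  note lin = tensor_add_left tensor_add_right tensor_smult_left tensor_smult_right
    bimoment_functional_add[OF L(1)] bimoment_functional_scale[OF L(1)]
    bimoment_functional_add[OF M(1)] bimoment_functional_scale[OF M(1)]
  have LM: "L (tensor (p n) (s m)) = M (tensor (p n) (s m))" for n m
    using L(2) M(2) by (simp add: biorthogonal_def)
  have basis: "L (tensor (p n) r) = M (tensor (p n) r)" for n r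
    by (rule linear_functional_eqI[OF s, where F = "\<lambda>r. L (tensor (p n) r)"
          and G = "\<lambda>r. M (tensor (p n) r)"]) (simp_all add: lin LM)
  show "L (tensor q r) = M (tensor q r)" for q r
    by (rule linear_functional_eqI[OF p, where F = "\<lambda>q. L (tensor q r)"
          and G = "\<lambda>q. M (tensor q r)"]) (simp_all add: lin basis)
qed

lemma biorthogonal_functional_exists:
  assumes p: "exact_degree_seq p" and s: "exact_degree_seq s"
  shows "\<exists>L. bimoment_functional L \<and> biorthogonal L p s"
proof -
  define B where "B q r = coeff_dot (coordinates p q) (coordinates s r)" for q r
  have "\<exists>L. bimoment_functional L \<and> (\<forall>q r. L (tensor q r) = B q r)"
    by (rule tensor_universal)
      (simp_all add: B_def p s coordinates_add coordinates_smult coeff_dot_add_left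
        coeff_dot_add_right coeff_dot_smult_left coeff_dot_smult_right)
  moreover have "B (p n) (s m) = (if n = m then 1 else 0)" for n m
    by (simp add: B_def p s coordinates_basis coeff_dot_monom)
  ultimately show ?thesis
    using p s by (auto simp: biorthogonal_def)
qed

section \<open>Degrees along the recurrence\<close>

text \<open>Multiplication by \<open>x\<close> raises the degree by one while the sum stays in degrees at most \<open>n\<close>, so
  \<open>p (n + 1)\<close> inherits the degree of \<open>x p n\<close>.\<close>

lemma recurrence_exact_degree_seq:
  assumes "p 0 \<noteq> 0" "degree (p 0) = 0"
    and rec: "\<And>n. [:0, 1:] * p n = smult (g n) (p (n + 1)) + (\<Sum>j=0..n. smult (a j n) (p (n - j)))"
    and g: "\<And>n. g n \<noteq> 0"
  shows "exact_degree_seq p"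
  unfolding exact_degree_seq_def
proof
  fix n show "p n \<noteq> 0 \<and> degree (p n) = n"
  proof (induction n rule: less_induct)
    case (less n)
    show ?case
    proof (cases n)
      case 0 then show ?thesis using assms(1,2) by simp
    next
      case (Suc k)
      let ?S = "\<Sum>j=0..k. smult (a j k) (p (k - j))"
      have "degree ?S \<le> k"
      proof (rule degree_sum_le)
        fix j assume "j \<in> {0..k}"
        then have "degree (p (k - j)) \<le> k" using less[of "k - j"] Suc by simp
        then show "degree (smult (a j k) (p (k - j))) \<le> k"
          by (rule order_trans[OF degree_smult_le])
      qed simp
      moreover have "degree ([:0, 1:] * p k) = Suc k"
        using less[of k] Suc by (simp add: degree_mult_eq)
      moreover have "smult (g k) (p n) = [:0, 1:] * p k - ?S"
        using rec[of k] Suc by simp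
      ultimately have "degree (smult (g k) (p n)) = degree ([:0, 1:] * p k)"
        by (simp only: diff_conv_add_uminus degree_add_eq_left degree_minus less_Suc_eq_le)
      then have "degree (smult (g k) (p n)) = n"
        using \<open>degree ([:0, 1:] * p k) = Suc k\<close> Suc by (simp only:)
      then have "degree (p n) = n" using g[of k] by simp
      then show ?thesis using Suc by auto
    qed
  qed
qed

section \<open>The biorthogonality functional\<close>

theorem theorem2p1:
  fixes \<gamma> \<gamma>' :: "nat \<Rightarrow> complex"
    and a b :: "nat \<Rightarrow> nat \<Rightarrow> complex"
    and \<pi> \<sigma> :: "nat \<Rightarrow> complex poly"
  assumes "\<pi> 0 \<noteq> 0" and "degree (\<pi> 0) = 0"
    and "\<sigma> 0 \<noteq> 0" and "degree (\<sigma> 0) = 0"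
    and "\<And>n. [:0, 1:] * \<pi> n = smult (\<gamma> n) (\<pi> (n + 1)) + (\<Sum>j=0..n. smult (a j n) (\<pi> (n - j)))"
    and "\<And>n. [:0, 1:] * \<sigma> n = smult (\<gamma>' n) (\<sigma> (n + 1)) + (\<Sum>j=0..n. smult (b j n) (\<sigma> (n - j)))"
    and "\<And>n. \<gamma> n \<noteq> 0" and "\<And>n. \<gamma>' n \<noteq> 0"
  shows "\<exists>!L. bimoment_functional L \<and> biorthogonal L \<pi> \<sigma>"
proof -
  have \<pi>: "exact_degree_seq \<pi>"
    by (rule recurrence_exact_degree_seq[OF assms(1,2,5,7)])
  have \<sigma>: "exact_degree_seq \<sigma>"
    by (rule recurrence_exact_degree_seq[OF assms(3,4,6,8)])
  show ?thesis
    using biorthogonal_functional_exists[OF \<pi> \<sigma>] biorthogonal_functional_unique by blast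
qed

end
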